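(* Let $f, f_1, f_2:\mathbb{Z}^n \to \mathbb{R} \cup \{+\infty\}$ be DDM-convex functions. Then the following hold. (1) For any $d\in\mathbb{Z}^n$, the function $g(x)=f(x+d)$ $(x\in\mathbb{Z}^n)$ is DDM-convex. (2) For any permutation $\sigma$ of $(1,\dots,n)$, the function $g(x)=f(x_{\sigma(1)},\dots,x_{\sigma(n)})$ $(x\in\mathbb{Z}^n)$ is DDM-convex. (3) For any $\tau\in\{+1,-1\}^n$, the function $g(x)=f(\tau\odot x)$ $(x\in\mathbb{Z}^n)$ is DDM-convex. (4) For any real $a_1,a_2\ge 0$, the function $g(x)=a_1f_1(x)+a_2f_2(x)$ $(x\in\mathbb{Z}^n)$ is DDM-convex.
   Context: For $x,y\in\mathbb{Z}^n$, the vector $\mu(x,y)\in\mathbb{Z}^n$ is defined componentwise by $\mu(x,y)_i=\lceil (x_i+y_i)/2\rceil$ if $x_i\ge y_i$, and $\mu(x,y)_i=\lfloor (x_i+y_i)/2\rfloor$ if $x_i<y_i$. A function $f:\mathbb{Z}^n\to\mathbb{R}\cup\{+\infty\}$ is called directed discrete midpoint convex (DDM-convex) if $f(x)+f(y)\ge f(\mu(x,y))+f(\mu(y,x))$ for all $x,y\in\mathbb{Z}^n$. For vectors $a,b$, $a\odot b=(a_1b_1,\dots,a_nb_n)$ denotes the componentwise product. *)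

theory Defs
  imports "HOL-Analysis.Analysis"
begin

definition ddm_midpoint :: "int ^ 'n \<Rightarrow> int ^ 'n \<Rightarrow> int ^ 'n" where
  "ddm_midpoint x y =
     (\<chi> i. if x $ i \<ge> y $ i then \<lceil>real_of_int (x $ i + y $ i) / 2\<rceil>
          else \<lfloor>real_of_int (x $ i + y $ i) / 2\<rfloor>)"

text \<open>The codomain of the functions is the real line extended by plus infinity only. Values are
  taken in \<^typ>\<open>ereal\<close>, so the value minus infinity is excluded as part of the definition.
  An effective domain that is empty is allowed. In nonnegative combinations of such functions, the
  library convention that zero times infinity is zero applies.\<close>

definition ddm_convex :: "(int ^ 'n \<Rightarrow> ereal) \<Rightarrow> bool" where
  "ddm_convex f \<longleftrightarrow>
     (\<forall>x. f x \<noteq> -\<infinity>) \<and>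
     (\<forall>x y. f x + f y \<ge> f (ddm_midpoint x y) + f (ddm_midpoint y x))"

end

theory Submission
  imports Defs
begin

text \<open>The inequality defining DDM-convexity mentions its arguments only through \<open>f\<close> and the
  midpoint map \<open>\<mu>\<close>. Precomposition with any \<open>h\<close> that commutes with \<open>\<mu>\<close> therefore preserves it
  (\<open>ddm_convex_compose\<close>), and parts (1)--(3) amount to the compatibility of \<open>\<mu>\<close> with
  translations, coordinate permutations and sign changes. Only sign changes need thought: negation
  exchanges ceiling and floor, but it also reverses the comparison of \<open>x\<^sub>i\<close> with \<open>y\<^sub>i\<close> that selects
  between them, so the two effects cancel. This is what the direction achieves: rounding all
  coordinates up in one midpoint and down in the other is disturbed by changing the sign of a single coordinate.

  Part (4) holds because such inequalities may be scaled by nonnegative reals and added. Since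
  \<open>-\<infinity>\<close> is excluded as a value, opposite infinities never meet in a sum, so a real factor can be
  taken out of \<open>f x + f y\<close> as usual.\<close>

lemma ddm_convex_compose:
  assumes "ddm_convex f"
    and "\<And>x y. h (ddm_midpoint x y) = ddm_midpoint (h x) (h y)"
  shows "ddm_convex (\<lambda>x. f (h x))"
  using assms by (simp add: ddm_convex_def)

text \<open>An integer shift of both arguments passes through the rounding, because it changes the half
  sum by an integer.\<close>

lemma ddm_midpoint_add:
  "ddm_midpoint x y + d = ddm_midpoint (x + d) (y + d)"
proof -
  have half: "real_of_int (a + c + (b + c)) / 2 = real_of_int (a + b) / 2 + real_of_int c"
    for a b c :: int
    by (simp add: field_simps)
  show ?thesis
    unfolding vec_eq_iff ddm_midpoint_def vector_add_component vec_lambda_beta half by simp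
qed

lemma ddm_midpoint_reindex:
  fixes x y :: "int ^ 'n" and \<sigma> :: "'m::finite \<Rightarrow> 'n"
  shows "(\<chi> i. ddm_midpoint x y $ \<sigma> i) = ddm_midpoint (\<chi> i. x $ \<sigma> i) (\<chi> i. y $ \<sigma> i)"
  by (simp add: vec_eq_iff ddm_midpoint_def)

text \<open>In a coordinate with sign \<open>-1\<close> and \<open>x\<^sub>i \<noteq> y\<^sub>i\<close>, the exchange of ceiling and floor is undone by
  the reversed comparison. If \<open>x\<^sub>i = y\<^sub>i\<close>, the comparison does not reverse, but the half sum is then
  an integer and no rounding takes place.\<close>

lemma ddm_midpoint_sign:
  assumes "\<And>i. \<tau> $ i \<in> {1, -1}"
  shows "\<tau> * ddm_midpoint x y = ddm_midpoint (\<tau> * x) (\<tau> * y)"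
proof -
  have neg: "real_of_int (- a + - b) / 2 = - (real_of_int (a + b) / 2)" for a b :: int
    by (simp add: field_simps)
  have "\<tau> $ i * ddm_midpoint x y $ i = ddm_midpoint (\<tau> * x) (\<tau> * y) $ i" for i
  proof (cases "\<tau> $ i = 1")
    case True
    then show ?thesis by (simp add: ddm_midpoint_def)
  next
    case False
    then have minus: "\<tau> $ i = -1" using assms[of i] by auto
    show ?thesis
    proof (cases "x $ i = y $ i")
      case True
      then show ?thesis by (simp add: ddm_midpoint_def minus ceiling_minus)
    next
      case False
      then show ?thesis
        unfolding ddm_midpoint_def vec_lambda_beta vector_mult_component minus mult_minus1 neg
          ceiling_minus floor_minus
        by auto
    qed
  qed
  then show ?thesis by (simp add: vec_eq_iff)
qed

text \<open>For \<open>a = 0\<close> and an infinite value of \<open>f\<close>, the product is \<open>0\<close>, so the scaled function is then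
  constantly zero and not the indicator of the effective domain of \<open>f\<close>.\<close>

lemma ddm_convex_scale:
  assumes "ddm_convex f" and "0 \<le> a"
  shows "ddm_convex (\<lambda>x. ereal a * f x)"
proof -
  have ninf: "f x \<noteq> -\<infinity>" for x
    using assms(1) by (simp add: ddm_convex_def)
  have distrib: "ereal a * f x + ereal a * f y = ereal a * (f x + f y)" for x y
    using ninf[of x] ninf[of y] by (cases "f x"; cases "f y") (auto simp: algebra_simps)
  have "ereal a * (f (ddm_midpoint x y) + f (ddm_midpoint y x)) \<le> ereal a * (f x + f y)" for x y
    using assms by (intro ereal_mult_left_mono) (auto simp: ddm_convex_def)
  moreover have "ereal a * f x \<noteq> -\<infinity>" for x
    using ninf[of x] assms(2) by (cases "f x") auto
  ultimately show ?thesis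
    by (simp add: ddm_convex_def distrib)
qed

lemma ddm_convex_add:
  assumes "ddm_convex f" and "ddm_convex g"
  shows "ddm_convex (\<lambda>x. f x + g x)"
proof -
  have "f (ddm_midpoint x y) + g (ddm_midpoint x y) + (f (ddm_midpoint y x) + g (ddm_midpoint y x))
      \<le> f x + g x + (f y + g y)" for x y
  proof -
    have "f (ddm_midpoint x y) + f (ddm_midpoint y x) + (g (ddm_midpoint x y) + g (ddm_midpoint y x))
        \<le> f x + f y + (g x + g y)"
      using assms by (intro add_mono[of "_ + _" "_ + _" "_ + _" "_ + _"]) (auto simp: ddm_convex_def)
    then show ?thesis by (simp add: ac_simps)
  qed
  then show ?thesis
    using assms by (simp add: ddm_convex_def)
qed

theorem proposition2p4:
  fixes f f1 f2 :: "int ^ 'n \<Rightarrow> ereal"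
  assumes "ddm_convex f" and "ddm_convex f1" and "ddm_convex f2"
  shows "(\<forall>d :: int ^ 'n. ddm_convex (\<lambda>x. f (x + d))) \<and>
         (\<forall>\<sigma> :: 'n \<Rightarrow> 'n. \<sigma> permutes UNIV \<longrightarrow> ddm_convex (\<lambda>x. f (\<chi> i. x $ \<sigma> i))) \<and>
         (\<forall>\<tau> :: int ^ 'n. (\<forall>i. \<tau> $ i \<in> {1, -1}) \<longrightarrow> ddm_convex (\<lambda>x. f (\<tau> * x))) \<and>
         (\<forall>a1 a2 :: real. a1 \<ge> 0 \<longrightarrow> a2 \<ge> 0 \<longrightarrow>
            ddm_convex (\<lambda>x. ereal a1 * f1 x + ereal a2 * f2 x))"
proof (intro conjI allI impI)
  show "ddm_convex (\<lambda>x. f (x + d))" for d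
    using assms(1) ddm_midpoint_add by (rule ddm_convex_compose)
next
  show "ddm_convex (\<lambda>x. f (\<chi> i. x $ \<sigma> i))" for \<sigma> :: "'n \<Rightarrow> 'n"
    using assms(1) ddm_midpoint_reindex by (rule ddm_convex_compose)
next
  show "ddm_convex (\<lambda>x. f (\<tau> * x))" if "\<forall>i. \<tau> $ i \<in> {1, -1}" for \<tau> :: "int ^ 'n"
    using assms(1) ddm_midpoint_sign[OF that[rule_format]] by (rule ddm_convex_compose)
next
  show "ddm_convex (\<lambda>x. ereal a1 * f1 x + ereal a2 * f2 x)" if "0 \<le> a1" "0 \<le> a2" for a1 a2 :: real
    using assms that by (intro ddm_convex_add ddm_convex_scale)
qed

end
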